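(* Let $i\in\{1,2,3\}$ and assume that $u_0$ satisfies hypothesis $(\mathbf{H_i})$, where $(\mathbf{H_1})$: $u_0\in L^\infty(\Omega)$, $u_0\ge1$ a.e. in $\Omega$, $u_0\not\equiv1$; $(\mathbf{H_2})$: $u_0\in L^\infty(\Omega)$, $0\le u_0\le1$ a.e. in $\Omega$, $\int_\Omega g(u_0(x))\,dx\ne0$; $(\mathbf{H_3})$: $u_0\in L^\infty(\Omega)$, $u_0\le0$ a.e. in $\Omega$, $u_0\not\equiv0$. Let $u$ be the solution of Problem $(P)$ on $[0,\infty)$. Then: (i) There exists $C>0$ such that for all $\tau_2>\tau_1\ge0$, $$E_i(u(\tau_2))-E_i(u(\tau_1))=(-1)^{i+1}\int_{\tau_1}^{\tau_2}\int_\Omega g(u)\,(p(u)-\lambda(t))^2\,dx\,dt\le -C\int_{\tau_1}^{\tau_2}\int_\Omega|u_t|^2\,dx\,dt\le0.$$ (ii) $t\mapsto E_i(u(t))$ is continuous and nonincreasing on $[0,\infty)$, and the limit $E_{i\infty}:=\lim_{t\to\infty}E_i(u(t))$ exists.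
   Context: Standing assumptions: $\Omega\subset\mathbb{R}^N$ ($N\ge1$) is an open bounded set; $p\in C^1(\mathbb{R})$ is strictly increasing on $\mathbb{R}$; $g\in C^1(\mathbb{R})$ satisfies $g(0)=g(1)=0$, $g>0$ on $(0,1)$ and $g<0$ on $(-\infty,0)\cup(1,\infty)$. For $v\in L^\infty(\Omega)$ with $\int_\Omega g(v)\ne0$ put $F(v):=g(v)p(v)-g(v)\dfrac{\int_\Omega g(v)p(v)}{\int_\Omega g(v)}$. Problem $(P)$ is the initial value problem $u_t=F(u)$, $t\ge0$, $u(x,0)=u_0(x)$, $x\in\Omega$. For $0<T\le\infty$, a function $u\in C^1([0,T);L^\infty(\Omega))$ is a solution of $(P)$ on $[0,T)$ if $u(0)=u_0$, $\int_\Omega g(u(t))\ne0$ for all $t\in[0,T)$, and $\frac{du}{dt}=F(u)$ on the whole interval $[0,T)$. Under any of $(\mathbf{H_1})$, $(\mathbf{H_2})$, $(\mathbf{H_3})$, Problem $(P)$ has a unique solution $u$ on $[0,\infty)$. Set $\lambda(t):=\dfrac{\int_\Omega g(u(t))p(u(t))}{\int_\Omega g(u(t))}$, $\mathcal{P}(s):=\int_0^s p(\tau)\,d\tau$ and, for $i=1,2,3$, $E_i(v):=(-1)^{i+1}\int_\Omega\mathcal{P}(v)$. *)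

theory Defs
  imports "HOL-Analysis.Analysis" "HOL-Probability.Essential_Supremum"
begin

text \<open>
  Elements of \<open>L\<^sup>\<infinity>(\<Omega>)\<close> are represented by functions; equality in \<open>L\<^sup>\<infinity>(\<Omega>)\<close> is equality
  almost everywhere with respect to \<^term>\<open>lebesgue_on \<Omega>\<close>, and no notion below distinguishes
  almost everywhere equal representatives. The norm takes values in \<^typ>\<open>ennreal\<close>, and it is
  \<open>\<infinity>\<close> if \<open>\<bar>v\<bar>\<close> is not measurable.
\<close>

definition Linf_norm :: "'a::euclidean_space set \<Rightarrow> ('a \<Rightarrow> real) \<Rightarrow> ennreal" where
  "Linf_norm \<Omega> v = esssup (lebesgue_on \<Omega>) (\<lambda>x. ennreal \<bar>v x\<bar>)"

definition Linf :: "'a::euclidean_space set \<Rightarrow> ('a \<Rightarrow> real) set" where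
  "Linf \<Omega> = {v. v \<in> borel_measurable (lebesgue_on \<Omega>) \<and> Linf_norm \<Omega> v < \<infinity>}"

definition has_Linf_derivative ::
    "'a::euclidean_space set \<Rightarrow> real set \<Rightarrow> (real \<Rightarrow> 'a \<Rightarrow> real) \<Rightarrow> ('a \<Rightarrow> real) \<Rightarrow> real \<Rightarrow> bool" where
  "has_Linf_derivative \<Omega> I u w t \<longleftrightarrow> w \<in> Linf \<Omega> \<and>
     ((\<lambda>s. Linf_norm \<Omega> (\<lambda>x. (u s x - u t x) / (s - t) - w x)) \<longlongrightarrow> 0) (at t within I)"

text \<open>
  A representative of the derivative \<open>u\<^sub>t\<close>, which is unique only up to equality almost everywhere.
\<close>

definition Linf_deriv ::
    "'a::euclidean_space set \<Rightarrow> real set \<Rightarrow> (real \<Rightarrow> 'a \<Rightarrow> real) \<Rightarrow> real \<Rightarrow> 'a \<Rightarrow> real" where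
  "Linf_deriv \<Omega> I u t = (SOME w. has_Linf_derivative \<Omega> I u w t)"

definition C1_Linf :: "'a::euclidean_space set \<Rightarrow> real set \<Rightarrow> (real \<Rightarrow> 'a \<Rightarrow> real) \<Rightarrow> bool" where
  "C1_Linf \<Omega> I u \<longleftrightarrow> (\<forall>t\<in>I. u t \<in> Linf \<Omega>) \<and>
     (\<exists>w. \<forall>t\<in>I. has_Linf_derivative \<Omega> I u (w t) t \<and>
        ((\<lambda>s. Linf_norm \<Omega> (\<lambda>x. w s x - w t x)) \<longlongrightarrow> 0) (at t within I))"

text \<open>The multiplier: \<open>\<lambda>(t)\<close> is \<open>multiplier \<Omega> p g (u t)\<close>.\<close>

definition multiplier ::
    "'a::euclidean_space set \<Rightarrow> (real \<Rightarrow> real) \<Rightarrow> (real \<Rightarrow> real) \<Rightarrow> ('a \<Rightarrow> real) \<Rightarrow> real" where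
  "multiplier \<Omega> p g v =
     (LINT x|lebesgue_on \<Omega>. g (v x) * p (v x)) / (LINT x|lebesgue_on \<Omega>. g (v x))"

definition nonlinearity ::
    "'a::euclidean_space set \<Rightarrow> (real \<Rightarrow> real) \<Rightarrow> (real \<Rightarrow> real) \<Rightarrow> ('a \<Rightarrow> real) \<Rightarrow> 'a \<Rightarrow> real" where
  "nonlinearity \<Omega> p g v x = g (v x) * p (v x) - g (v x) * multiplier \<Omega> p g v"

definition solution_P ::
    "'a::euclidean_space set \<Rightarrow> (real \<Rightarrow> real) \<Rightarrow> (real \<Rightarrow> real) \<Rightarrow> ('a \<Rightarrow> real) \<Rightarrow> ereal \<Rightarrow>
       (real \<Rightarrow> 'a \<Rightarrow> real) \<Rightarrow> bool" where
  "solution_P \<Omega> p g u0 T u \<longleftrightarrow>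
     (let I = {t. 0 \<le> t \<and> ereal t < T} in
        C1_Linf \<Omega> I u \<and>
        (AE x in lebesgue_on \<Omega>. u 0 x = u0 x) \<and>
        (\<forall>t\<in>I. (LINT x|lebesgue_on \<Omega>. g (u t x)) \<noteq> 0) \<and>
        (\<forall>t\<in>I. has_Linf_derivative \<Omega> I u (nonlinearity \<Omega> p g (u t)) t))"

definition H1 :: "'a::euclidean_space set \<Rightarrow> ('a \<Rightarrow> real) \<Rightarrow> bool" where
  "H1 \<Omega> u0 \<longleftrightarrow> u0 \<in> Linf \<Omega> \<and> (AE x in lebesgue_on \<Omega>. u0 x \<ge> 1) \<and>
     \<not> (AE x in lebesgue_on \<Omega>. u0 x = 1)"

definition H2 :: "'a::euclidean_space set \<Rightarrow> (real \<Rightarrow> real) \<Rightarrow> ('a \<Rightarrow> real) \<Rightarrow> bool" where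
  "H2 \<Omega> g u0 \<longleftrightarrow> u0 \<in> Linf \<Omega> \<and> (AE x in lebesgue_on \<Omega>. 0 \<le> u0 x \<and> u0 x \<le> 1) \<and>
     (LINT x|lebesgue_on \<Omega>. g (u0 x)) \<noteq> 0"

definition H3 :: "'a::euclidean_space set \<Rightarrow> ('a \<Rightarrow> real) \<Rightarrow> bool" where
  "H3 \<Omega> u0 \<longleftrightarrow> u0 \<in> Linf \<Omega> \<and> (AE x in lebesgue_on \<Omega>. u0 x \<le> 0) \<and>
     \<not> (AE x in lebesgue_on \<Omega>. u0 x = 0)"

definition primitive :: "(real \<Rightarrow> real) \<Rightarrow> real \<Rightarrow> real" where
  "primitive p s = (LBINT \<tau>=0..s. p \<tau>)"

definition energy ::
    "'a::euclidean_space set \<Rightarrow> (real \<Rightarrow> real) \<Rightarrow> nat \<Rightarrow> ('a \<Rightarrow> real) \<Rightarrow> real" where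
  "energy \<Omega> p i v = (-1) ^ (i + 1) * (LINT x|lebesgue_on \<Omega>. primitive p (v x))"

end

theory Submission
  imports Defs
begin

text \<open>
  For each \<open>t\<close> only the class of \<open>u t\<close> modulo null sets is known, so instead of solving the equation
  pointwise in \<open>x\<close> one works with integrals \<open>\<integral> \<phi> (u t)\<close> for \<open>\<phi>\<close> of class \<open>C\<^sup>1\<close>, which obey the chain
  rule in \<open>t\<close>. Gronwall's inequality for \<open>\<integral> (\<sigma> (u - c))\<^sub>+\<^sup>2\<close> shows that the equilibria \<open>0\<close> and \<open>1\<close> are
  barriers, so \<open>g (u)\<close> keeps its sign; if \<open>g (u) \<le> 0\<close>, also the initial bound on \<open>\<bar>u\<bar>\<close> persists, because
  \<open>\<lambda>\<close> is then an average of \<open>p (u)\<close>. The energy identity is the chain rule for the primitive of \<open>p\<close>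
  combined with \<open>\<integral> g (u) (p (u) - \<lambda>) = 0\<close>, and \<open>u\<^sub>t\<^sup>2 = g (u)\<^sup>2 (p (u) - \<lambda>)\<^sup>2\<close> is at most \<open>sup \<bar>g (u)\<bar>\<close> times
  the dissipation density.
\<close>

section \<open>Derivatives in \<open>L\<^sup>\<infinity>\<close> and the chain rule under the integral\<close>

lemma AE_abs_less_Linf_norm:
  assumes "Linf_norm \<Omega> v < ennreal e"
  shows "AE x in lebesgue_on \<Omega>. \<bar>v x\<bar> < e"
proof -
  have "AE x in lebesgue_on \<Omega>. ennreal \<bar>v x\<bar> \<le> Linf_norm \<Omega> v"
    unfolding Linf_norm_def by (rule esssup_AE)
  then show ?thesis
  proof eventually_elim
    case (elim x)
    then have "ennreal \<bar>v x\<bar> < ennreal e" using assms by (rule le_less_trans)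
    then show ?case by (simp add: ennreal_less_iff)
  qed
qed

lemma Linf_AE_bounded:
  assumes "v \<in> Linf \<Omega>"
  obtains R where "0 < R" "AE x in lebesgue_on \<Omega>. \<bar>v x\<bar> \<le> R"
proof -
  from assms have "Linf_norm \<Omega> v < top" by (simp add: Linf_def)
  then obtain r where "Linf_norm \<Omega> v = ennreal r" "0 \<le> r"
    by (cases "Linf_norm \<Omega> v") auto
  then have "Linf_norm \<Omega> v < ennreal (r + 1)" by (simp add: ennreal_lessI)
  from AE_abs_less_Linf_norm[OF this] have "AE x in lebesgue_on \<Omega>. \<bar>v x\<bar> \<le> r + 1"
    by eventually_elim simp
  with \<open>0 \<le> r\<close> that[of "r + 1"] show thesis by simp
qed

text \<open>Each pair \<open>(k, n)\<close> with \<open>n \<ge> N k\<close> contributes one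
  exceptional null set. Restricting to sequences keeps these countable, so their union is still
  null.\<close>

lemma Linf_norm_tendsto_0_AE:
  fixes v :: "nat \<Rightarrow> 'a::euclidean_space \<Rightarrow> real"
  assumes "(\<lambda>n. Linf_norm \<Omega> (v n)) \<longlonglongrightarrow> 0"
  shows "AE x in lebesgue_on \<Omega>. (\<lambda>n. v n x) \<longlonglongrightarrow> 0"
proof -
  have "\<exists>N. \<forall>n\<ge>N. Linf_norm \<Omega> (v n) < ennreal (1 / Suc k)" for k
    using order_tendstoD(2)[OF assms, of "ennreal (1 / Suc k)"]
    by (simp add: eventually_sequentially)
  then obtain N where N: "\<And>k n. n \<ge> N k \<Longrightarrow> Linf_norm \<Omega> (v n) < ennreal (1 / Suc k)"
    by metis
  have "AE x in lebesgue_on \<Omega>. \<forall>k n. n \<ge> N k \<longrightarrow> \<bar>v n x\<bar> < 1 / Suc k"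
    using AE_abs_less_Linf_norm[OF N] by (simp add: AE_all_countable)
  then show ?thesis
  proof eventually_elim
    case (elim x)
    show ?case
    proof (rule LIMSEQ_I)
      fix r :: real assume "0 < r"
      then obtain k where "1 / Suc k < r"
        using nat_approx_posE by blast
      with elim show "\<exists>no. \<forall>n\<ge>no. norm (v n x - 0) < r"
        by (intro exI[of _ "N k"]) (auto intro: less_trans)
    qed
  qed
qed

text \<open>A single difference quotient close to both candidates forces them to agree a.e. up to
  \<open>2 / Suc k\<close>. Such a quotient exists because the filter is nontrivial, and countably
  many \<open>k\<close> give equality a.e.\<close>

lemma has_Linf_derivative_unique:
  assumes w1: "has_Linf_derivative \<Omega> I u w1 t" and w2: "has_Linf_derivative \<Omega> I u w2 t"
    and nt: "at t within I \<noteq> bot"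
  shows "AE x in lebesgue_on \<Omega>. w1 x = w2 x"
proof -
  have "AE x in lebesgue_on \<Omega>. \<bar>w1 x - w2 x\<bar> < 2 / Suc k" for k
  proof -
    have "\<forall>\<^sub>F s in at t within I. Linf_norm \<Omega> (\<lambda>x. (u s x - u t x) / (s - t) - w1 x) < ennreal (1 / Suc k)"
      "\<forall>\<^sub>F s in at t within I. Linf_norm \<Omega> (\<lambda>x. (u s x - u t x) / (s - t) - w2 x) < ennreal (1 / Suc k)"
      using w1 w2 unfolding has_Linf_derivative_def by (auto intro!: order_tendstoD(2))
    then have "\<forall>\<^sub>F s in at t within I. AE x in lebesgue_on \<Omega>. \<bar>w1 x - w2 x\<bar> < 2 / Suc k"
    proof eventually_elim
      case (elim s)
      from AE_abs_less_Linf_norm[OF elim(1)] AE_abs_less_Linf_norm[OF elim(2)] show ?case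
        by eventually_elim linarith
    qed
    from eventually_happens'[OF nt this] show ?thesis by simp
  qed
  then have "AE x in lebesgue_on \<Omega>. \<forall>k. \<bar>w1 x - w2 x\<bar> < 2 / Suc k"
    by (simp add: AE_all_countable)
  then show ?thesis
  proof eventually_elim
    case (elim x)
    show ?case
    proof (rule ccontr)
      assume "w1 x \<noteq> w2 x"
      then obtain k where "1 / Suc k < \<bar>w1 x - w2 x\<bar> / 2"
        using nat_approx_posE[of "\<bar>w1 x - w2 x\<bar> / 2"] by auto
      with elim[rule_format, of k] show False by simp
    qed
  qed
qed

lemma C1_lipschitz_on_interval:
  fixes \<phi> :: "real \<Rightarrow> real"
  assumes \<phi>: "\<And>y. (\<phi> has_real_derivative \<phi>' y) (at y)" and cont: "continuous_on UNIV \<phi>'"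
  obtains L where "0 < L" "\<And>a b. \<bar>a\<bar> \<le> R \<Longrightarrow> \<bar>b\<bar> \<le> R \<Longrightarrow> \<bar>\<phi> a - \<phi> b\<bar> \<le> L * \<bar>a - b\<bar>"
proof -
  have "bounded (\<phi>' ` {-R..R})"
    by (intro compact_imp_bounded compact_continuous_image continuous_on_subset[OF cont]) auto
  then obtain L where L: "0 < L" "\<And>y. y \<in> {-R..R} \<Longrightarrow> norm (\<phi>' y) \<le> L"
    by (auto simp: bounded_pos)
  have "\<bar>\<phi> a - \<phi> b\<bar> \<le> L * \<bar>a - b\<bar>" if "\<bar>a\<bar> \<le> R" "\<bar>b\<bar> \<le> R" for a b
    using field_differentiable_bound[of "{-R..R}" \<phi> \<phi>' L a b] L(2) that
      has_field_derivative_at_within[OF \<phi>] by (auto simp: abs_le_iff)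
  with L(1) that show thesis by blast
qed

lemma continuous_bounded_on_interval:
  fixes h :: "real \<Rightarrow> real"
  assumes "continuous_on {a..b} h"
  obtains B where "0 < B" "\<And>y. y \<in> {a..b} \<Longrightarrow> \<bar>h y\<bar> \<le> B"
proof -
  have "bounded (h ` {a..b})"
    by (intro compact_imp_bounded compact_continuous_image assms) auto
  then show thesis using that by (auto simp: bounded_pos)
qed

lemma integrable_compose_bounded:
  fixes h :: "real \<Rightarrow> real"
  assumes "finite_measure M" "continuous_on UNIV h" "v \<in> borel_measurable M"
    and bd: "AE x in M. \<bar>v x\<bar> \<le> R"
  shows "integrable M (\<lambda>x. h (v x))"
proof -
  obtain B where B: "0 < B" "\<And>y. y \<in> {-R..R} \<Longrightarrow> \<bar>h y\<bar> \<le> B"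
    using continuous_bounded_on_interval[OF continuous_on_subset[OF assms(2)], of "-R" R] by auto
  have "h \<in> borel_measurable borel"
    using assms(2) by (rule borel_measurable_continuous_onI)
  with assms(3) have "(\<lambda>x. h (v x)) \<in> borel_measurable M" by measurable
  moreover from bd have "AE x in M. norm (h (v x)) \<le> B"
    by eventually_elim (use B(2) in \<open>auto simp: abs_le_iff\<close>)
  ultimately show ?thesis
    by (intro finite_measure.integrable_const_bound[OF assms(1), of _ B])
qed

lemma everywhere_deriv_continuous_on:
  fixes \<phi> :: "real \<Rightarrow> real"
  assumes "\<And>y. (\<phi> has_real_derivative \<phi>' y) (at y)"
  shows "continuous_on S \<phi>"
  using assms DERIV_continuous by (blast intro: continuous_at_imp_continuous_on)

text \<open>This is dominated convergence along sequences tending to \<open>t\<close>. Essential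
  bounds confine all values to one compact interval, where \<phi> is Lipschitz, so the difference
  quotients of \<phi> along \<open>u\<close> have a constant majorant, integrable on a finite
  measure space.\<close>

lemma has_Linf_derivative_integral_compose:
  fixes \<phi> :: "real \<Rightarrow> real"
  assumes fin: "finite_measure (lebesgue_on \<Omega>)"
    and u: "\<And>s. s \<in> I \<Longrightarrow> u s \<in> Linf \<Omega>" and t: "t \<in> I"
    and der: "has_Linf_derivative \<Omega> I u w t"
    and \<phi>: "\<And>y. (\<phi> has_real_derivative \<phi>' y) (at y)" and cont: "continuous_on UNIV \<phi>'"
  shows "((\<lambda>s. LINT x|lebesgue_on \<Omega>. \<phi> (u s x)) has_real_derivative
           (LINT x|lebesgue_on \<Omega>. \<phi>' (u t x) * w x)) (at t within I)"
proof -
  let ?M = "lebesgue_on \<Omega>"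
  obtain R where R: "0 < R" "AE x in ?M. \<bar>u t x\<bar> \<le> R"
    using Linf_AE_bounded[OF u[OF t]] .
  have "w \<in> Linf \<Omega>" using der by (simp add: has_Linf_derivative_def)
  then obtain W where W: "0 < W" "AE x in ?M. \<bar>w x\<bar> \<le> W"
    by (rule Linf_AE_bounded)
  have meas_u: "u s \<in> borel_measurable ?M" if "s \<in> I" for s
    using u[OF that] by (simp add: Linf_def)
  have meas_w: "w \<in> borel_measurable ?M" using \<open>w \<in> Linf \<Omega>\<close> by (simp add: Linf_def)
  have cont_\<phi>: "continuous_on UNIV \<phi>"
    using \<phi> by (rule everywhere_deriv_continuous_on)
  have meas_\<phi>: "\<phi> \<in> borel_measurable borel" "\<phi>' \<in> borel_measurable borel"
    using cont cont_\<phi> by (auto intro: borel_measurable_continuous_onI)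
  \<comment> \<open>Once the quotient is within 1 of \<open>w\<close> and the time step is below 1,
    \<open>u\<close> moves by at most \<open>W + 1\<close> from a value of size at most
    \<open>R\<close>.\<close>
  obtain L where L: "0 < L"
    "\<And>a b. \<bar>a\<bar> \<le> R + W + 1 \<Longrightarrow> \<bar>b\<bar> \<le> R + W + 1 \<Longrightarrow> \<bar>\<phi> a - \<phi> b\<bar> \<le> L * \<bar>a - b\<bar>"
    using C1_lipschitz_on_interval[OF \<phi> cont, of "R + W + 1"] by metis
  show ?thesis
    unfolding has_field_derivative_iff tendsto_at_iff_sequentially
  proof (intro allI impI)
    fix X :: "nat \<Rightarrow> real"
    assume X: "\<forall>i. X i \<in> I - {t}" "X \<longlonglongrightarrow> t"
    let ?q = "\<lambda>n x. (u (X n) x - u t x) / (X n - t)"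
    have "filterlim X (at t within I) sequentially"
      using X by (simp add: filterlim_at)
    then have lim: "(\<lambda>n. Linf_norm \<Omega> (\<lambda>x. ?q n x - w x)) \<longlonglongrightarrow> 0"
      using der unfolding has_Linf_derivative_def by (auto elim: filterlim_compose)
    have "\<forall>\<^sub>F n in sequentially. Linf_norm \<Omega> (\<lambda>x. ?q n x - w x) < ennreal 1 \<and> \<bar>X n - t\<bar> < 1"
      using order_tendstoD(2)[OF lim, of 1] tendstoD[OF X(2), of 1]
      by (auto simp: dist_real_def elim: eventually_elim2)
    then obtain N where N: "\<And>n. n \<ge> N \<Longrightarrow> Linf_norm \<Omega> (\<lambda>x. ?q n x - w x) < ennreal 1"
      "\<And>n. n \<ge> N \<Longrightarrow> \<bar>X n - t\<bar> < 1"
      by (auto simp: eventually_sequentially)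
    have conv: "AE x in ?M. (\<lambda>n. ?q n x - w x) \<longlonglongrightarrow> 0"
      by (rule Linf_norm_tendsto_0_AE[OF lim])
    let ?f = "\<lambda>n x. (\<phi> (u (X n) x) - \<phi> (u t x)) / (X n - t)"
    have step: "\<bar>u (X n) x\<bar> \<le> R + W + 1 \<and> \<bar>?f n x\<bar> \<le> L * (W + 1)"
      if "\<bar>?q n x - w x\<bar> < 1" "\<bar>X n - t\<bar> < 1" "\<bar>w x\<bar> \<le> W" "\<bar>u t x\<bar> \<le> R" for n x
    proof -
      have nz: "X n \<noteq> t" using X(1) by auto
      have q: "\<bar>?q n x\<bar> \<le> W + 1" using that by linarith
      have eq: "\<bar>u (X n) x - u t x\<bar> = \<bar>?q n x\<bar> * \<bar>X n - t\<bar>" using nz by simp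
      also have "\<dots> \<le> (W + 1) * 1"
        using q that W(1) by (intro mult_mono) auto
      finally have "\<bar>u (X n) x - u t x\<bar> \<le> W + 1" by simp
      with that(4) have bd: "\<bar>u (X n) x\<bar> \<le> R + W + 1" by linarith
      have "\<bar>\<phi> (u (X n) x) - \<phi> (u t x)\<bar> \<le> L * \<bar>u (X n) x - u t x\<bar>"
        using bd that W(1) by (intro L) auto
      also have "\<dots> \<le> L * (W + 1) * \<bar>X n - t\<bar>"
        unfolding eq mult.assoc using L(1) by (intro mult_left_mono mult_right_mono q) auto
      finally show ?thesis using bd nz by (simp add: field_simps)
    qed
    \<comment> \<open>The majorant is available only from index \<open>N\<close> on, hence the
      shifted sequence; \<open>LIMSEQ_offset\<close> removes the shift at the end.\<close>
    have "(\<lambda>n. LINT x|?M. ?f (n + N) x) \<longlonglongrightarrow> (LINT x|?M. \<phi>' (u t x) * w x)"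
    proof (rule integral_dominated_convergence[where w = "\<lambda>_. L * (W + 1)"])
      show "(\<lambda>x. \<phi>' (u t x) * w x) \<in> borel_measurable ?M"
        using meas_w meas_\<phi> meas_u[OF t] by measurable
      show "?f (n + N) \<in> borel_measurable ?M" for n
        using X(1) t by (intro borel_measurable_divide borel_measurable_diff borel_measurable_const
            measurable_compose[OF meas_u meas_\<phi>(1)]) auto
      show "integrable ?M (\<lambda>_. L * (W + 1))"
        using fin by (simp add: finite_measure.integrable_const)
      show "AE x in ?M. norm (?f (n + N) x) \<le> L * (W + 1)" for n
        using AE_abs_less_Linf_norm[OF N(1)[OF le_add2, of n]] R(2) W(2)
        by eventually_elim (use step[OF _ N(2)] in auto)
      show "AE x in ?M. (\<lambda>n. ?f (n + N) x) \<longlonglongrightarrow> \<phi>' (u t x) * w x"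
        using conv
      proof eventually_elim
        case (elim x)
        then have q: "(\<lambda>n. ?q n x) \<longlonglongrightarrow> w x" by (simp add: LIM_zero_iff)
        have "(\<lambda>n. u t x + ?q n x * (X n - t)) \<longlonglongrightarrow> u t x + w x * (t - t)"
          by (intro tendsto_intros q X(2))
        then have ulim: "(\<lambda>n. u (X n) x) \<longlonglongrightarrow> u t x" using X(1) by simp
        \<comment> \<open>Caratheodory's form of differentiability avoids dividing by
          \<open>u (X n) x - u t x\<close>, which may vanish.\<close>
        obtain G where G: "\<And>z. \<phi> z - \<phi> (u t x) = G z * (z - u t x)" "isCont G (u t x)"
          "G (u t x) = \<phi>' (u t x)"
          using \<phi>[of "u t x"] unfolding CARAT_DERIV by auto
        have "(\<lambda>n. G (u (X n) x) * ?q n x) \<longlonglongrightarrow> G (u t x) * w x"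
          by (intro tendsto_intros q isCont_tendsto_compose[OF G(2)] ulim)
        moreover have "G (u (X n) x) * ?q n x = ?f n x" for n
          using G(1)[of "u (X n) x"] by simp
        ultimately have "(\<lambda>n. ?f n x) \<longlonglongrightarrow> \<phi>' (u t x) * w x"
          by (simp only: G(3))
        then show ?case by (rule LIMSEQ_ignore_initial_segment)
      qed
    qed
    moreover have "(LINT x|?M. ?f n x) =
      ((LINT x|?M. \<phi> (u (X n) x)) - (LINT x|?M. \<phi> (u t x))) / (X n - t)" for n
    proof -
      have int: "integrable ?M (\<lambda>x. \<phi> (u s x))" if "s \<in> I" for s
        using Linf_AE_bounded[OF u[OF that]] integrable_compose_bounded[OF fin cont_\<phi> meas_u[OF that]]
        by metis
      show ?thesis using int[of "X n"] int[OF t] X(1) by simp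
    qed
    ultimately have lim': "(\<lambda>n. ((LINT x|?M. \<phi> (u (X (n + N)) x)) - (LINT x|?M. \<phi> (u t x))) / (X (n + N) - t))
        \<longlonglongrightarrow> (LINT x|?M. \<phi>' (u t x) * w x)"
      by (simp only:)
    show "((\<lambda>s. ((LINT x|?M. \<phi> (u s x)) - (LINT x|?M. \<phi> (u t x))) / (s - t)) \<circ> X)
        \<longlonglongrightarrow> (LINT x|?M. \<phi>' (u t x) * w x)"
      unfolding comp_def by (rule LIMSEQ_offset[where k = N]) (rule lim')
  qed
qed

section \<open>Real analysis\<close>

text \<open>The function \<open>f t * exp (- K * t)\<close> is nonincreasing and starts at 0, so
  \<open>f\<close> is nonpositive as well as nonnegative. Below, \<open>f\<close> is the integral of
  a squared excess over a barrier.\<close>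

lemma gronwall_vanish:
  fixes f f' :: "real \<Rightarrow> real"
  assumes der: "\<And>t. t \<in> {0..T} \<Longrightarrow> (f has_real_derivative f' t) (at t within {0..})"
    and le: "\<And>t. t \<in> {0..T} \<Longrightarrow> f' t \<le> K * f t"
    and nonneg: "\<And>t. t \<in> {0..T} \<Longrightarrow> 0 \<le> f t" and "f 0 = 0" and t: "t \<in> {0..T}"
  shows "f t = 0"
proof -
  let ?h = "\<lambda>s. f s * exp (- K * s)"
  have h: "(?h has_real_derivative (f' s - K * f s) * exp (- K * s)) (at s within {0..})"
    if "s \<in> {0..T}" for s
    by (auto intro!: derivative_eq_intros der[OF that] simp: algebra_simps)
  have "?h t \<le> ?h 0"
  proof (rule DERIV_nonpos_imp_decreasing_open[of 0 t ?h])
    show "0 \<le> t" using t by simp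
    have "continuous_on {0..t} f"
      using t by (auto simp: continuous_on_eq_continuous_within
          intro!: DERIV_continuous[OF has_field_derivative_subset[OF der]])
    then show "continuous_on {0..t} ?h" by (intro continuous_intros)
    fix s assume s: "0 < s" "s < t"
    have at: "at s within {0..} = at s"
      using s by (intro at_within_interior) (simp add: interior_real_atLeast)
    have "(?h has_real_derivative (f' s - K * f s) * exp (- K * s)) (at s within {0..})"
      using s t by (intro h) auto
    then have "(?h has_real_derivative (f' s - K * f s) * exp (- K * s)) (at s)"
      unfolding at .
    moreover have "(f' s - K * f s) * exp (- K * s) \<le> 0"
      using le[of s] s t by (simp add: mult_nonpos_nonneg)
    ultimately show "\<exists>y. (?h has_real_derivative y) (at s) \<and> y \<le> 0" by blast
  qed
  then have "f t \<le> 0" using \<open>f 0 = 0\<close> by (simp add: mult_le_0_iff)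
  with nonneg[OF t] show ?thesis by simp
qed

text \<open>Squaring makes the positive part continuously differentiable, so that the chain rule
  under the integral applies to it.\<close>

lemma has_real_derivative_pos_part_square:
  "((\<lambda>y. (max 0 y)\<^sup>2) has_real_derivative 2 * max 0 y) (at y)"
proof -
  consider "y < 0" | "y = 0" | "0 < y" by linarith
  then show ?thesis
  proof cases
    case 1
    have "((\<lambda>_. 0) has_real_derivative 2 * max 0 y) (at y)" using 1 by simp
    then show ?thesis
      by (rule has_field_derivative_transform_within_open[where S = "{..<0}"]) (use 1 in auto)
  next
    case 2
    show ?thesis unfolding CARAT_DERIV
      \<comment> \<open>At the kink \<open>(max 0 z)\<^sup>2 = max 0 z * z\<close>, so
        \<open>max 0\<close> itself is the Caratheodory slope.\<close>
      by (rule exI[of _ "max 0"]) (auto simp: 2 max_def power2_eq_square continuous_max)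
  next
    case 3
    have "((\<lambda>y. y\<^sup>2) has_real_derivative 2 * max 0 y) (at y)"
      using 3 by (auto intro!: derivative_eq_intros)
    then show ?thesis
      by (rule has_field_derivative_transform_within_open[where S = "{0<..}"]) (use 3 in auto)
  qed
qed

lemma C1_has_real_derivative:
  assumes "f C1_differentiable_on UNIV"
  obtains f' where "\<And>y. (f has_real_derivative f' y) (at y)" "continuous_on UNIV f'"
  using assms unfolding C1_differentiable_on_def has_real_derivative_iff_has_vector_derivative
  by auto

lemma has_real_derivative_primitive:
  assumes "continuous_on UNIV p"
  shows "(primitive p has_real_derivative p y) (at y)"
proof -
  \<comment> \<open>The interval contains the base point 0 and has \<open>y\<close> in its interior,
    which turns the derivative within it into a full derivative.\<close>
  let ?a = "- \<bar>y\<bar> - 1" and ?b = "\<bar>y\<bar> + 1"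
  have "((\<lambda>u. LBINT \<tau>=(0::real)..u. p \<tau>) has_vector_derivative p y) (at y within {?a..?b})"
    by (rule interval_integral_FTC2) (auto intro: continuous_on_subset[OF assms])
  moreover have "at y within {?a..?b} = at y"
    by (rule at_within_interior) (auto simp: interior_atLeastAtMost_real)
  ultimately show ?thesis
    by (simp add: primitive_def[abs_def] has_real_derivative_iff_has_vector_derivative zero_ereal_def)
qed

text \<open>This is the Cauchy-Schwarz inequality against the constant 1, obtained by integrating
  \<open>2 * f x * f y \<le> (f x)\<^sup>2 + (f y)\<^sup>2\<close> first in \<open>y\<close> and
  then in \<open>x\<close>.\<close>

lemma square_integral_le:
  fixes f :: "'b \<Rightarrow> real"
  assumes "finite_measure M" and f: "integrable M f" and f2: "integrable M (\<lambda>x. (f x)\<^sup>2)"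
  shows "(integral\<^sup>L M f)\<^sup>2 \<le> measure M (space M) * (LINT x|M. (f x)\<^sup>2)"
proof -
  interpret finite_measure M by fact
  let ?m = "measure M (space M)" and ?Z = "integral\<^sup>L M f" and ?Q = "LINT x|M. (f x)\<^sup>2"
  have "2 * f x * ?Z \<le> ?m * (f x)\<^sup>2 + ?Q" for x
  proof -
    have "(LINT y|M. 2 * f x * f y) \<le> (LINT y|M. (f x)\<^sup>2 + (f y)\<^sup>2)"
      using f f2 by (intro integral_mono) (auto simp: sum_squares_bound)
    then show ?thesis using f f2 by (simp add: mult.commute)
  qed
  then have "(LINT x|M. 2 * f x * ?Z) \<le> (LINT x|M. ?m * (f x)\<^sup>2 + ?Q)"
    using f f2 by (intro integral_mono) auto
  then have "2 * ?Z * ?Z \<le> ?m * ?Q + ?m * ?Q" using f f2 by simp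
  then show ?thesis by (simp add: power2_eq_square)
qed

lemma antimono_on_bounded_below_convergent:
  fixes f :: "real \<Rightarrow> real"
  assumes anti: "antimono_on {a..} f" and bdd: "\<And>t. a \<le> t \<Longrightarrow> B \<le> f t"
  shows "(f \<longlongrightarrow> (INF t\<in>{a..}. f t)) at_top"
proof (rule order_tendstoI)
  have B: "bdd_below (f ` {a..})" using bdd by (auto intro: bdd_belowI[of _ B])
  fix y :: real
  {
    assume "y < (INF t\<in>{a..}. f t)"
    moreover have "(INF t\<in>{a..}. f t) \<le> f t" if "a \<le> t" for t
      using B that by (intro cINF_lower) auto
    ultimately have "y < f t" if "a \<le> t" for t using that by (meson less_le_trans)
    then show "\<forall>\<^sub>F t in at_top. y < f t"
      by (auto intro: eventually_mono[OF eventually_ge_at_top[of a]])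
  next
    assume "(INF t\<in>{a..}. f t) < y"
    then obtain s where s: "a \<le> s" "f s < y"
      using B by (auto simp: cINF_less_iff)
    then have "f t < y" if "s \<le> t" for t
      using monotone_onD[OF anti, of s t] that by auto
    then show "\<forall>\<^sub>F t in at_top. f t < y"
      by (auto intro: eventually_mono[OF eventually_ge_at_top[of s]])
  }
qed

text \<open>Bridge from the gauge integral, in which the fundamental theorem of calculus is stated,
  to the Lebesgue integral in time.\<close>

lemma has_integral_lebesgue_on_Icc:
  fixes f :: "real \<Rightarrow> real"
  assumes "continuous_on {a..b} f" "(f has_integral y) {a..b}"
  shows "integral\<^sup>L (lebesgue_on {a..b}) f = y"
  using lebesgue_integral_eq_integral[OF continuous_imp_integrable_real[OF assms(1)]]
    integral_unique[OF assms(2)] by simp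

section \<open>One-sided bounds along the flow\<close>

text \<open>Only regularity and the evolution equation are fixed here. Monotonicity of
  \<open>p\<close> and the sign of \<open>g (u)\<close> enter as premises of individual lemmas, so
  the three initial regimes share one setting.\<close>

locale nonlocal_flow =
  fixes \<Omega> :: "'a::euclidean_space set" and p g p' g' :: "real \<Rightarrow> real"
    and u :: "real \<Rightarrow> 'a \<Rightarrow> real"
  assumes finite_domain: "finite_measure (lebesgue_on \<Omega>)"
    and p_deriv: "\<And>y. (p has_real_derivative p' y) (at y)" and p'_cont: "continuous_on UNIV p'"
    and g_deriv: "\<And>y. (g has_real_derivative g' y) (at y)" and g'_cont: "continuous_on UNIV g'"
    and u_Linf: "\<And>t. 0 \<le> t \<Longrightarrow> u t \<in> Linf \<Omega>"
    and mass_nonzero: "\<And>t. 0 \<le> t \<Longrightarrow> (LINT x|lebesgue_on \<Omega>. g (u t x)) \<noteq> 0"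
    and flow: "\<And>t. 0 \<le> t \<Longrightarrow> has_Linf_derivative \<Omega> {0..} u (nonlinearity \<Omega> p g (u t)) t"
begin

abbreviation M :: "'a measure" where "M \<equiv> lebesgue_on \<Omega>"

abbreviation lam :: "real \<Rightarrow> real" where "lam t \<equiv> multiplier \<Omega> p g (u t)"

lemma cont_p: "continuous_on S p" and cont_g: "continuous_on S g"
  using p_deriv g_deriv by (blast intro: everywhere_deriv_continuous_on)+

lemma u_measurable: "0 \<le> t \<Longrightarrow> u t \<in> borel_measurable M"
  using u_Linf[of t] by (simp add: Linf_def)

lemma nonlinearity_eq: "nonlinearity \<Omega> p g (u t) x = g (u t x) * (p (u t x) - lam t)"
  by (simp add: nonlinearity_def algebra_simps)

lemma integrable_compose:
  fixes h :: "real \<Rightarrow> real"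
  assumes "0 \<le> t" "continuous_on UNIV h"
  shows "integrable M (\<lambda>x. h (u t x))"
  using Linf_AE_bounded[OF u_Linf[OF assms(1)]]
    integrable_compose_bounded[OF finite_domain assms(2) u_measurable[OF assms(1)]] by metis

lemma integral_compose_deriv:
  fixes \<phi> :: "real \<Rightarrow> real"
  assumes "0 \<le> t" "\<And>y. (\<phi> has_real_derivative \<phi>' y) (at y)" "continuous_on UNIV \<phi>'"
  shows "((\<lambda>s. LINT x|M. \<phi> (u s x)) has_real_derivative
           (LINT x|M. \<phi>' (u t x) * (g (u t x) * (p (u t x) - lam t)))) (at t within {0..})"
proof -
  have "((\<lambda>s. LINT x|M. \<phi> (u s x)) has_real_derivative
           (LINT x|M. \<phi>' (u t x) * nonlinearity \<Omega> p g (u t) x)) (at t within {0..})"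
    using assms by (intro has_Linf_derivative_integral_compose finite_domain u_Linf flow) auto
  then show ?thesis by (simp only: nonlinearity_eq)
qed

lemma integral_compose_cont:
  fixes \<phi> :: "real \<Rightarrow> real"
  assumes "\<And>y. (\<phi> has_real_derivative \<phi>' y) (at y)" "continuous_on UNIV \<phi>'"
  shows "continuous_on {0..} (\<lambda>t. LINT x|M. \<phi> (u t x))"
  by (auto simp: continuous_on_eq_continuous_within
      intro!: DERIV_continuous[OF integral_compose_deriv[OF _ assms]])

text \<open>These moments suffice for all later continuity in time: \<open>lam\<close> is a quotient
  of two of them, and weighted variances are combinations of them with coefficients built from
  \<open>lam\<close>.\<close>

lemma cont_integral_g_p_powers:
  "continuous_on {0..} (\<lambda>t. LINT x|M. g (u t x) ^ j * p (u t x) ^ k)"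
proof (rule integral_compose_cont[where \<phi> = "\<lambda>y. g y ^ j * p y ^ k"])
  show "((\<lambda>y. g y ^ j * p y ^ k) has_real_derivative
      of_nat j * (g y ^ (j - 1) * g' y) * p y ^ k + g y ^ j * (of_nat k * (p y ^ (k - 1) * p' y))) (at y)"
    for y
    by (auto intro!: derivative_eq_intros p_deriv g_deriv)
  show "continuous_on UNIV (\<lambda>y. of_nat j * (g y ^ (j - 1) * g' y) * p y ^ k +
      g y ^ j * (of_nat k * (p y ^ (k - 1) * p' y)))"
    by (intro continuous_intros cont_p cont_g p'_cont g'_cont)
qed

lemma cont_mass: "continuous_on {0..} (\<lambda>t. LINT x|M. g (u t x))"
  using cont_integral_g_p_powers[of 1 0] by simp

lemma cont_lam: "continuous_on {0..} lam"
  unfolding multiplier_def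
  using cont_integral_g_p_powers[of 1 1] by (auto intro!: continuous_intros cont_mass mass_nonzero)

text \<open>Differentiability at \<open>t\<close> bounds \<open>u s\<close> uniformly for
  \<open>s\<close> near \<open>t\<close>, and a Bolzano argument patches the local bounds together.
  The bound is uniform in time, whereas the exceptional null set may depend on the time.\<close>

lemma bounded_on_compact_time:
  obtains R where "0 < R" "\<And>t. t \<in> {0..T} \<Longrightarrow> AE x in M. \<bar>u t x\<bar> \<le> R"
proof (cases "0 \<le> T")
  case True
  \<comment> \<open>Small intervals around 0 may reach into negative times, where nothing is known;
    hence the intersection with \<open>{0..}\<close>.\<close>
  define P where "P a b \<longleftrightarrow> (\<exists>R>0. \<forall>s\<in>{a..b} \<inter> {0..}. AE x in M. \<bar>u s x\<bar> \<le> R)" for a b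
  have "P 0 T"
    using True
  proof (induction rule: Bolzano)
    case (trans a b c)
    then obtain R1 R2 where R: "0 < R1" "\<forall>s\<in>{a..b} \<inter> {0..}. AE x in M. \<bar>u s x\<bar> \<le> R1"
      "0 < R2" "\<forall>s\<in>{b..c} \<inter> {0..}. AE x in M. \<bar>u s x\<bar> \<le> R2"
      unfolding P_def by blast
    have "AE x in M. \<bar>u s x\<bar> \<le> max R1 R2" if "s \<in> {a..c} \<inter> {0..}" for s
    proof (cases "s \<le> b")
      case True
      with R(2) that have "AE x in M. \<bar>u s x\<bar> \<le> R1" by auto
      then show ?thesis by eventually_elim simp
    next
      case False
      with R(4) that have "AE x in M. \<bar>u s x\<bar> \<le> R2" by auto
      then show ?thesis by eventually_elim simp
    qed
    with R show ?case unfolding P_def by (intro exI[of _ "max R1 R2"]) auto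
  next
    case (local t)
    let ?w = "nonlinearity \<Omega> p g (u t)"
    obtain R where R: "0 < R" "AE x in M. \<bar>u t x\<bar> \<le> R"
      using Linf_AE_bounded[OF u_Linf[OF local(1)]] .
    have w: "?w \<in> Linf \<Omega>"
      "((\<lambda>s. Linf_norm \<Omega> (\<lambda>x. (u s x - u t x) / (s - t) - ?w x)) \<longlongrightarrow> 0) (at t within {0..})"
      using flow[OF local(1)] by (simp_all add: has_Linf_derivative_def)
    obtain W where W: "0 < W" "AE x in M. \<bar>?w x\<bar> \<le> W"
      using Linf_AE_bounded[OF w(1)] .
    from order_tendstoD(2)[OF w(2), of "ennreal 1"] obtain d where d: "0 < d"
      "\<And>s. s \<in> {0..} \<Longrightarrow> s \<noteq> t \<Longrightarrow> dist s t < d \<Longrightarrow>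
         Linf_norm \<Omega> (\<lambda>x. (u s x - u t x) / (s - t) - ?w x) < ennreal 1"
      by (auto simp: eventually_at)
    have near: "AE x in M. \<bar>u s x\<bar> \<le> R + W + 1" if s: "0 \<le> s" "\<bar>s - t\<bar> < min 1 d" for s
    proof (cases "s = t")
      case True
      from R(2) show ?thesis unfolding True by eventually_elim (use W(1) in simp)
    next
      case False
      from AE_abs_less_Linf_norm[OF d(2)[of s]] s False
      have "AE x in M. \<bar>(u s x - u t x) / (s - t) - ?w x\<bar> < 1"
        by (simp add: dist_real_def)
      with R(2) W(2) show ?thesis
      proof eventually_elim
        case (elim x)
        let ?q = "(u s x - u t x) / (s - t)"
        have "\<bar>?q\<bar> \<le> W + 1" using elim by linarith
        moreover have "\<bar>u s x - u t x\<bar> = \<bar>?q\<bar> * \<bar>s - t\<bar>" using False by simp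
        moreover have "\<bar>?q\<bar> * \<bar>s - t\<bar> \<le> \<bar>?q\<bar> * 1"
          using s by (intro mult_left_mono) auto
        ultimately have "\<bar>u s x - u t x\<bar> \<le> W + 1" by linarith
        with elim(1) show ?case by linarith
      qed
    qed
    have "P a b" if "a \<le> t" "t \<le> b" "b - a < min 1 d" for a b
      unfolding P_def
    proof (intro exI[of _ "R + W + 1"] conjI ballI)
      show "0 < R + W + 1" using R(1) W(1) by simp
      fix s assume "s \<in> {a..b} \<inter> {0..}"
      with that show "AE x in M. \<bar>u s x\<bar> \<le> R + W + 1" by (intro near) auto
    qed
    with d(1) show ?case by (intro exI[of _ "min 1 d"]) auto
  qed
  with that show thesis unfolding P_def by auto
qed (use that[of 1] in auto)

text \<open>
  The one-sided bound \<open>\<sigma> (u - c) \<le> 0\<close> (with \<open>\<sigma> = \<plusminus>1\<close>) is expressed by the vanishing of the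
  integral of the squared positive part, which is differentiable in time although \<open>u t\<close> is only
  a representative modulo null sets for each \<open>t\<close>.
\<close>
lemma one_sided_bound_of_differential_inequality:
  assumes init: "AE x in M. \<sigma> * (u 0 x - c) \<le> 0"
    and ineq: "\<And>T. 0 \<le> T \<Longrightarrow> \<exists>K. \<forall>t\<in>{0..T}.
      (LINT x|M. 2 * max 0 (\<sigma> * (u t x - c)) * (\<sigma> * (g (u t x) * (p (u t x) - lam t))))
        \<le> K * (LINT x|M. (max 0 (\<sigma> * (u t x - c)))\<^sup>2)"
    and T: "0 \<le> T"
  shows "AE x in M. \<sigma> * (u T x - c) \<le> 0"
proof -
  let ?\<phi> = "\<lambda>y. (max 0 (\<sigma> * (y - c)))\<^sup>2"
  obtain K where K: "\<And>t. t \<in> {0..T} \<Longrightarrow>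
      (LINT x|M. 2 * max 0 (\<sigma> * (u t x - c)) * (\<sigma> * (g (u t x) * (p (u t x) - lam t))))
        \<le> K * (LINT x|M. ?\<phi> (u t x))"
    using ineq[OF T] by blast
  have \<phi>: "(?\<phi> has_real_derivative 2 * max 0 (\<sigma> * (y - c)) * \<sigma>) (at y)" for y
    by (rule DERIV_chain2[OF has_real_derivative_pos_part_square]) (auto intro!: derivative_eq_intros)
  have cont: "continuous_on UNIV (\<lambda>y. 2 * max 0 (\<sigma> * (y - c)) * \<sigma>)"
    by (intro continuous_intros)
  have "(LINT x|M. ?\<phi> (u T x)) = 0"
  proof (rule gronwall_vanish[of T "\<lambda>t. LINT x|M. ?\<phi> (u t x)"])
    show "((\<lambda>t. LINT x|M. ?\<phi> (u t x)) has_real_derivative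
      (LINT x|M. 2 * max 0 (\<sigma> * (u t x - c)) * (\<sigma> * (g (u t x) * (p (u t x) - lam t)))))
      (at t within {0..})" if "t \<in> {0..T}" for t
      using integral_compose_deriv[OF _ \<phi> cont, of t] that by (simp add: mult.assoc)
    have "AE x in M. ?\<phi> (u 0 x) = 0"
      using init by eventually_elim (simp add: max_def)
    then show "(LINT x|M. ?\<phi> (u 0 x)) = 0" by (rule integral_eq_zero_AE)
  qed (use K T in auto)
  moreover have "integrable M (\<lambda>x. ?\<phi> (u T x))"
    using T by (intro integrable_compose continuous_intros)
  ultimately have "AE x in M. ?\<phi> (u T x) = 0"
    by (subst (asm) integral_nonneg_eq_0_iff_AE) auto
  then show ?thesis by eventually_elim (auto simp: max_def split: if_splits)
qed

text \<open>Since \<open>g c = 0\<close>, the Lipschitz bound gives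
  \<open>\<bar>g y\<bar> \<le> L * \<bar>y - c\<bar>\<close>. The growth rate of the squared excess
  is then at most a constant times the squared excess itself, pointwise in \<open>x\<close>. The
  sign \<sigma> treats upper and lower barriers together.\<close>

lemma equilibrium_barrier:
  assumes \<sigma>: "\<bar>\<sigma>\<bar> = 1" and c: "g c = 0"
    and init: "AE x in M. \<sigma> * (u 0 x - c) \<le> 0" and t0: "0 \<le> t"
  shows "AE x in M. \<sigma> * (u t x - c) \<le> 0"
proof (rule one_sided_bound_of_differential_inequality[OF init _ t0])
  fix T :: real assume "0 \<le> T"
  obtain R0 where R0: "0 < R0" "\<And>t. t \<in> {0..T} \<Longrightarrow> AE x in M. \<bar>u t x\<bar> \<le> R0"
    using bounded_on_compact_time[of T] by blast
  \<comment> \<open>The Lipschitz interval must contain the comparison point \<open>c\<close> in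
    addition to the values of \<open>u\<close>.\<close>
  let ?R = "max R0 \<bar>c\<bar>"
  obtain L where L: "0 < L" "\<And>a b. \<bar>a\<bar> \<le> ?R \<Longrightarrow> \<bar>b\<bar> \<le> ?R \<Longrightarrow> \<bar>g a - g b\<bar> \<le> L * \<bar>a - b\<bar>"
    using C1_lipschitz_on_interval[OF g_deriv g'_cont, of ?R] by metis
  obtain B where B: "0 < B" "\<And>y. y \<in> {-R0..R0} \<Longrightarrow> \<bar>p y\<bar> \<le> B"
    using continuous_bounded_on_interval[OF cont_p, of "-R0" R0] by blast
  \<comment> \<open>The multiplier is continuous in time because the mass in its denominator never
    vanishes, so it is bounded on \<open>{0..T}\<close>.\<close>
  obtain \<Lambda> where \<Lambda>: "0 < \<Lambda>" "\<And>t. t \<in> {0..T} \<Longrightarrow> \<bar>lam t\<bar> \<le> \<Lambda>"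
    using continuous_bounded_on_interval[OF continuous_on_subset[OF cont_lam], of 0 T] by auto
  let ?z = "\<lambda>y. max 0 (\<sigma> * (y - c))"
  have "(LINT x|M. 2 * ?z (u t x) * (\<sigma> * (g (u t x) * (p (u t x) - lam t))))
      \<le> 2 * L * (B + \<Lambda>) * (LINT x|M. (?z (u t x))\<^sup>2)" if t: "t \<in> {0..T}" for t
  proof -
    have "(LINT x|M. 2 * ?z (u t x) * (\<sigma> * (g (u t x) * (p (u t x) - lam t))))
      \<le> (LINT x|M. 2 * L * (B + \<Lambda>) * (?z (u t x))\<^sup>2)"
    proof (rule integral_mono_AE)
      show "integrable M (\<lambda>x. 2 * ?z (u t x) * (\<sigma> * (g (u t x) * (p (u t x) - lam t))))"
        using t by (intro integrable_compose[of t "\<lambda>y. 2 * ?z y * (\<sigma> * (g y * (p y - lam t)))"]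
            continuous_intros cont_p cont_g) auto
      show "integrable M (\<lambda>x. 2 * L * (B + \<Lambda>) * (?z (u t x))\<^sup>2)"
        using t by (intro integrable_compose[of t "\<lambda>y. 2 * L * (B + \<Lambda>) * (?z y)\<^sup>2"]
            continuous_intros cont_p cont_g) auto
      show "AE x in M. 2 * ?z (u t x) * (\<sigma> * (g (u t x) * (p (u t x) - lam t)))
          \<le> 2 * L * (B + \<Lambda>) * (?z (u t x))\<^sup>2"
        using R0(2)[OF t]
      proof eventually_elim
        case (elim x)
        let ?y = "u t x"
        have "\<bar>g ?y\<bar> \<le> L * \<bar>?y - c\<bar>" using L(2)[of ?y c] c elim by auto
        moreover have "\<bar>p ?y - lam t\<bar> \<le> B + \<Lambda>"
          using B(2)[of ?y] \<Lambda>(2)[OF t] elim by (auto simp: abs_le_iff)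
        ultimately have "\<bar>g ?y\<bar> * \<bar>p ?y - lam t\<bar> \<le> L * \<bar>?y - c\<bar> * (B + \<Lambda>)"
          by (intro mult_mono) (use L(1) in auto)
        moreover have "\<sigma> * (g ?y * (p ?y - lam t)) \<le> \<bar>g ?y\<bar> * \<bar>p ?y - lam t\<bar>"
          using \<sigma> abs_ge_self[of "\<sigma> * (g ?y * (p ?y - lam t))"] by (simp add: abs_mult)
        ultimately have "2 * ?z ?y * (\<sigma> * (g ?y * (p ?y - lam t)))
            \<le> 2 * ?z ?y * (L * \<bar>?y - c\<bar> * (B + \<Lambda>))"
          by (intro mult_left_mono) auto
        also have "?z ?y * \<bar>?y - c\<bar> = (?z ?y)\<^sup>2"
        proof (cases "0 \<le> \<sigma> * (?y - c)")
          case True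
          then have "\<bar>?y - c\<bar> = \<sigma> * (?y - c)"
            using \<sigma> abs_of_nonneg[OF True] by (simp add: abs_mult)
          with True show ?thesis by (simp add: max_def power2_eq_square)
        qed (simp add: max_def)
        then have "2 * ?z ?y * (L * \<bar>?y - c\<bar> * (B + \<Lambda>)) = 2 * L * (B + \<Lambda>) * (?z ?y)\<^sup>2"
          by (simp add: algebra_simps)
        finally show ?case .
      qed
    qed
    then show ?thesis by simp
  qed
  then show "\<exists>K. \<forall>t\<in>{0..T}. (LINT x|M. 2 * ?z (u t x) * (\<sigma> * (g (u t x) * (p (u t x) - lam t))))
      \<le> K * (LINT x|M. (?z (u t x))\<^sup>2)"
    by blast
qed

text \<open>
  If \<open>g (u) \<le> 0\<close> throughout, then \<open>\<lambda>\<close> is an average of \<open>p (u)\<close> with nonnegative weights, so it exceeds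
  \<open>p m\<close> by at most a multiple of the mass of \<open>u\<close> beyond the level \<open>m\<close>.
\<close>
lemma level_barrier:
  assumes \<sigma>: "\<bar>\<sigma>\<bar> = 1" and mono: "mono p" and g_le: "\<And>t. 0 \<le> t \<Longrightarrow> AE x in M. g (u t x) \<le> 0"
    and init: "AE x in M. \<sigma> * (u 0 x - m) \<le> 0" and t0: "0 \<le> t"
  shows "AE x in M. \<sigma> * (u t x - m) \<le> 0"
proof (rule one_sided_bound_of_differential_inequality[OF init _ t0])
  fix T :: real assume "0 \<le> T"
  obtain R0 where R0: "0 < R0" "\<And>t. t \<in> {0..T} \<Longrightarrow> AE x in M. \<bar>u t x\<bar> \<le> R0"
    using bounded_on_compact_time[of T] by blast
  let ?R = "max R0 \<bar>m\<bar>"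
  obtain L where L: "0 < L" "\<And>a b. \<bar>a\<bar> \<le> ?R \<Longrightarrow> \<bar>b\<bar> \<le> ?R \<Longrightarrow> \<bar>p a - p b\<bar> \<le> L * \<bar>a - b\<bar>"
    using C1_lipschitz_on_interval[OF p_deriv p'_cont, of ?R] by metis
  obtain G where G: "0 < G" "\<And>y. y \<in> {-R0..R0} \<Longrightarrow> \<bar>g y\<bar> \<le> G"
    using continuous_bounded_on_interval[OF cont_g, of "-R0" R0] by blast
  have "continuous_on {0..T} (\<lambda>t. 1 / (LINT x|M. g (u t x)))"
    by (intro continuous_intros continuous_on_subset[OF cont_mass]) (auto simp: mass_nonzero)
  then obtain B where B: "0 < B" "\<And>t. t \<in> {0..T} \<Longrightarrow> \<bar>1 / (LINT x|M. g (u t x))\<bar> \<le> B"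
    by (rule continuous_bounded_on_interval) auto
  let ?z = "\<lambda>y. max 0 (\<sigma> * (y - m))"
  have \<sigma>_cases: "\<sigma> = 1 \<or> \<sigma> = -1" using \<sigma> by linarith
  have "(LINT x|M. 2 * ?z (u t x) * (\<sigma> * (g (u t x) * (p (u t x) - lam t))))
      \<le> 2 * (G * (B * (G * L))) * measure M (space M) * (LINT x|M. (?z (u t x))\<^sup>2)"
    if t: "t \<in> {0..T}" for t
  proof -
    have t': "0 \<le> t" using t by simp
    let ?Z = "LINT x|M. ?z (u t x)" and ?D = "LINT x|M. - g (u t x)"
    let ?K = "B * (G * L)"
    have int: "integrable M (\<lambda>x. g (u t x))" "integrable M (\<lambda>x. g (u t x) * p (u t x))"
      "integrable M (\<lambda>x. ?z (u t x))" "integrable M (\<lambda>x. (?z (u t x))\<^sup>2)"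
      by (intro integrable_compose[OF t', of g] integrable_compose[OF t', of "\<lambda>y. g y * p y"]
        integrable_compose[OF t', of ?z] integrable_compose[OF t', of "\<lambda>y. (?z y)\<^sup>2"]
        continuous_intros cont_p cont_g)+
    have Z: "0 \<le> ?Z" by simp
    have D: "0 < ?D" "1 / ?D \<le> B"
    proof -
      have "0 \<le> ?D" using g_le[OF t'] by (intro integral_nonneg_AE) auto
      then show "0 < ?D" using mass_nonzero[OF t'] by simp
      then show "1 / ?D \<le> B" using B(2)[OF t] by simp
    qed
    \<comment> \<open>Beyond the level this is the Lipschitz bound; on the other side monotonicity
      of \<open>p\<close> makes the left side nonpositive, while the excess is zero.\<close>
    have lip: "\<sigma> * (p (u t x) - p m) \<le> L * ?z (u t x)" if "\<bar>u t x\<bar> \<le> R0" for x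
    proof -
      have "\<bar>p (u t x) - p m\<bar> \<le> L * \<bar>u t x - m\<bar>" using L(2)[of "u t x" m] that by auto
      then show ?thesis
        using \<sigma>_cases monoD[OF mono, of "u t x" m] monoD[OF mono, of m "u t x"] L(1)
        by (auto simp: max_def abs_if split: if_splits)
    qed
    \<comment> \<open>With the nonnegative weights \<open>- g (u)\<close>, the deviation of the
      average \<open>lam t\<close> from \<open>p m\<close> is the average of the deviations of
      \<open>p (u)\<close>.\<close>
    have "\<sigma> * (lam t - p m) * ?D = (LINT x|M. - g (u t x) * (\<sigma> * (p (u t x) - p m)))"
    proof -
      have "lam t * (LINT x|M. g (u t x)) = (LINT x|M. g (u t x) * p (u t x))"
        using mass_nonzero[OF t'] by (simp add: multiplier_def)
      moreover have "(LINT x|M. - g (u t x) * (\<sigma> * (p (u t x) - p m))) =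
          (LINT x|M. \<sigma> * p m * g (u t x) - \<sigma> * (g (u t x) * p (u t x)))"
        by (intro Bochner_Integration.integral_cong) (auto simp: algebra_simps)
      ultimately show ?thesis using int by (simp add: algebra_simps)
    qed
    also have "\<dots> \<le> (LINT x|M. G * L * ?z (u t x))"
    proof (rule integral_mono_AE)
      show "integrable M (\<lambda>x. - g (u t x) * (\<sigma> * (p (u t x) - p m)))"
        by (intro integrable_compose[OF t', of "\<lambda>y. - g y * (\<sigma> * (p y - p m))"]
            continuous_intros cont_p cont_g)
      show "integrable M (\<lambda>x. G * L * ?z (u t x))" using int(3) by simp
      show "AE x in M. - g (u t x) * (\<sigma> * (p (u t x) - p m)) \<le> G * L * ?z (u t x)"
        using R0(2)[OF t] g_le[OF t']
      proof eventually_elim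
        case (elim x)
        have "- g (u t x) * (\<sigma> * (p (u t x) - p m)) \<le> - g (u t x) * (L * ?z (u t x))"
          using elim lip[of x] by (intro mult_left_mono) auto
        also have "\<dots> \<le> G * (L * ?z (u t x))"
          using elim G(2)[of "u t x"] L(1) by (intro mult_right_mono) (auto simp: abs_le_iff)
        finally show ?case by (simp add: mult.assoc)
      qed
    qed
    finally have "\<sigma> * (lam t - p m) * ?D \<le> G * L * ?Z" by simp
    then have "\<sigma> * (lam t - p m) \<le> G * L * ?Z / ?D"
      using D(1) by (simp only: pos_le_divide_eq)
    also have "\<dots> = 1 / ?D * (G * L * ?Z)" by simp
    also have "\<dots> \<le> B * (G * L * ?Z)"
      using D(2) G(1) L(1) Z by (intro mult_right_mono) auto
    finally have lam_le: "\<sigma> * (lam t - p m) \<le> ?K * ?Z" by (simp add: mult.assoc)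
    have "(LINT x|M. 2 * ?z (u t x) * (\<sigma> * (g (u t x) * (p (u t x) - lam t))))
      \<le> (LINT x|M. 2 * (G * (?K * ?Z)) * ?z (u t x))"
    proof (rule integral_mono_AE)
      show "integrable M (\<lambda>x. 2 * ?z (u t x) * (\<sigma> * (g (u t x) * (p (u t x) - lam t))))"
        by (intro integrable_compose[OF t', of "\<lambda>y. 2 * ?z y * (\<sigma> * (g y * (p y - lam t)))"]
            continuous_intros cont_p cont_g)
      show "integrable M (\<lambda>x. 2 * (G * (?K * ?Z)) * ?z (u t x))" using int(3) by simp
      show "AE x in M. 2 * ?z (u t x) * (\<sigma> * (g (u t x) * (p (u t x) - lam t)))
          \<le> 2 * (G * (?K * ?Z)) * ?z (u t x)"
        using R0(2)[OF t] g_le[OF t']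
      proof eventually_elim
        case (elim x)
        show ?case
        \<comment> \<open>Only points beyond the level contribute. There \<open>p (u)\<close> lies
          beyond \<open>p m\<close>, so the estimate of \<open>lam t\<close> against
          \<open>p m\<close> also controls \<open>lam t\<close> against
          \<open>p (u)\<close>.\<close>
        proof (cases "0 < \<sigma> * (u t x - m)")
          case True
          then have "\<sigma> * p m \<le> \<sigma> * p (u t x)"
            using \<sigma>_cases monoD[OF mono, of "u t x" m] monoD[OF mono, of m "u t x"] by auto
          with lam_le have "\<sigma> * (lam t - p (u t x)) \<le> ?K * ?Z" by (simp add: right_diff_distrib)
          then have "- g (u t x) * (\<sigma> * (lam t - p (u t x))) \<le> - g (u t x) * (?K * ?Z)"
            using elim by (intro mult_left_mono) auto
          also have "\<dots> \<le> G * (?K * ?Z)"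
            using elim G(2)[of "u t x"] L(1) G(1) B(1) Z
            by (intro mult_right_mono) (auto simp: abs_le_iff)
          finally have "\<sigma> * (g (u t x) * (p (u t x) - lam t)) \<le> G * (?K * ?Z)"
            by (simp add: algebra_simps)
          from mult_left_mono[OF this, of "2 * ?z (u t x)"] show ?thesis
            by (simp add: mult_ac)
        qed (simp add: max_def)
      qed
    qed
    \<comment> \<open>The nonlocal term produces the square of an integral; Cauchy-Schwarz turns it
      into the integral of the square needed for Gronwall.\<close>
    also have "\<dots> = 2 * (G * ?K) * ?Z\<^sup>2" by (simp add: power2_eq_square)
    also have "\<dots> \<le> 2 * (G * ?K) * (measure M (space M) * (LINT x|M. (?z (u t x))\<^sup>2))"
      using G(1) B(1) L(1) by (intro mult_left_mono square_integral_le finite_domain int) auto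
    finally show ?thesis by (simp add: mult.assoc)
  qed
  then show "\<exists>K. \<forall>t\<in>{0..T}. (LINT x|M. 2 * ?z (u t x) * (\<sigma> * (g (u t x) * (p (u t x) - lam t))))
      \<le> K * (LINT x|M. (?z (u t x))\<^sup>2)"
    by blast
qed

section \<open>Energy dissipation\<close>

text \<open>Expanding the square pulls \<open>lam t\<close> out of the space integral. The case
  \<open>j = 1\<close> is the dissipation density, and \<open>j = 2\<close> is the integral of the
  squared time derivative.\<close>

lemma cont_integral_weighted_variance:
  "continuous_on {0..} (\<lambda>t. LINT x|M. g (u t x) ^ j * (p (u t x) - lam t)\<^sup>2)"
proof -
  have "continuous_on {0..} (\<lambda>t. (LINT x|M. g (u t x) ^ j * p (u t x) ^ 2)
      - 2 * lam t * (LINT x|M. g (u t x) ^ j * p (u t x) ^ 1)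
      + (lam t)\<^sup>2 * (LINT x|M. g (u t x) ^ j * p (u t x) ^ 0))" (is "continuous_on _ ?f")
    by (intro continuous_intros cont_lam cont_integral_g_p_powers)
  moreover have "?f t = (LINT x|M. g (u t x) ^ j * (p (u t x) - lam t)\<^sup>2)" if "t \<in> {0..}" for t
  proof -
    have int: "integrable M (\<lambda>x. g (u t x) ^ j * p (u t x) ^ k)" for k
      using that by (intro integrable_compose[of t "\<lambda>y. g y ^ j * p y ^ k"]
          continuous_intros cont_p cont_g) auto
    have "(LINT x|M. g (u t x) ^ j * (p (u t x) - lam t)\<^sup>2) =
      (LINT x|M. g (u t x) ^ j * p (u t x) ^ 2 - 2 * lam t * (g (u t x) ^ j * p (u t x) ^ 1)
        + (lam t)\<^sup>2 * (g (u t x) ^ j * p (u t x) ^ 0))"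
      by (intro Bochner_Integration.integral_cong) (auto simp: power2_eq_square algebra_simps)
    also have "\<dots> = ?f t"
      using int[of 0] int[of 1] int[of 2] by simp
    finally show ?thesis by simp
  qed
  ultimately show ?thesis by (rule continuous_on_eq)
qed

text \<open>Since \<open>\<integral> g (u) (p (u) - \<lambda>) = 0\<close>, the factor \<open>p (u)\<close> may be replaced by \<open>p (u) - \<lambda>\<close>.\<close>
lemma potential_deriv:
  assumes t: "0 \<le> t"
  shows "((\<lambda>s. LINT x|M. primitive p (u s x)) has_real_derivative
      (LINT x|M. g (u t x) * (p (u t x) - lam t)\<^sup>2)) (at t within {0..})"
proof -
  have int: "integrable M (\<lambda>x. g (u t x))" "integrable M (\<lambda>x. g (u t x) * p (u t x))"
    "integrable M (\<lambda>x. g (u t x) * (p (u t x) - lam t)\<^sup>2)"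
    by (intro integrable_compose[OF t, of g] integrable_compose[OF t, of "\<lambda>y. g y * p y"]
        integrable_compose[OF t, of "\<lambda>y. g y * (p y - lam t)\<^sup>2"] continuous_intros cont_p cont_g)+
  have "(LINT x|M. p (u t x) * (g (u t x) * (p (u t x) - lam t))) =
      (LINT x|M. g (u t x) * (p (u t x) - lam t)\<^sup>2
        + lam t * (g (u t x) * p (u t x) - lam t * g (u t x)))"
    by (intro Bochner_Integration.integral_cong) (auto simp: power2_eq_square algebra_simps)
  also have "\<dots> = (LINT x|M. g (u t x) * (p (u t x) - lam t)\<^sup>2)
        + lam t * ((LINT x|M. g (u t x) * p (u t x)) - lam t * (LINT x|M. g (u t x)))"
    using int by simp
  also have "\<dots> = (LINT x|M. g (u t x) * (p (u t x) - lam t)\<^sup>2)"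
    using mass_nonzero[OF t] by (simp add: multiplier_def)
  finally show ?thesis
    using integral_compose_deriv[OF t has_real_derivative_primitive[OF cont_p] cont_p] by simp
qed

lemma cont_potential: "continuous_on {0..} (\<lambda>t. LINT x|M. primitive p (u t x))"
  by (auto simp: continuous_on_eq_continuous_within intro!: DERIV_continuous[OF potential_deriv])

lemma potential_difference:
  assumes "0 \<le> a" "a \<le> b"
  shows "(LINT t|lebesgue_on {a..b}. LINT x|M. g (u t x) * (p (u t x) - lam t)\<^sup>2)
    = (LINT x|M. primitive p (u b x)) - (LINT x|M. primitive p (u a x))"
proof (rule has_integral_lebesgue_on_Icc)
  show "continuous_on {a..b} (\<lambda>t. LINT x|M. g (u t x) * (p (u t x) - lam t)\<^sup>2)"
    using cont_integral_weighted_variance[of 1] assms by (auto elim: continuous_on_subset)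
  show "((\<lambda>t. LINT x|M. g (u t x) * (p (u t x) - lam t)\<^sup>2) has_integral
      (LINT x|M. primitive p (u b x)) - (LINT x|M. primitive p (u a x))) {a..b}"
    by (rule fundamental_theorem_of_calculus[OF assms(2)],
        unfold has_real_derivative_iff_has_vector_derivative[symmetric],
        rule has_field_derivative_subset[OF potential_deriv]) (use assms in auto)
qed

text \<open>The representative picked by \<open>SOME\<close> is arbitrary, but uniqueness a.e.
  identifies it with the right-hand side of the equation.\<close>

lemma Linf_deriv_AE:
  assumes t: "0 \<le> t"
  shows "AE x in M. Linf_deriv \<Omega> {0..} u t x = g (u t x) * (p (u t x) - lam t)"
proof -
  have "has_Linf_derivative \<Omega> {0..} u (Linf_deriv \<Omega> {0..} u t) t"
    unfolding Linf_deriv_def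
    by (rule someI[of "\<lambda>w. has_Linf_derivative \<Omega> {0..} u w t", OF flow[OF t]])
  \<comment> \<open>Every \<open>t\<close> is approached from the right inside \<open>{0..}\<close>,
    including \<open>t = 0\<close>.\<close>
  moreover have "at t within {0..} \<noteq> bot"
  proof
    assume "at t within {0..} = bot"
    moreover have "at_right t \<le> at t within {0..}" using t by (intro at_le) auto
    ultimately show False using trivial_limit_at_right_real[of t] by (simp add: bot_unique)
  qed
  ultimately have "AE x in M. Linf_deriv \<Omega> {0..} u t x = nonlinearity \<Omega> p g (u t) x"
    by (intro has_Linf_derivative_unique[OF _ flow[OF t]])
  then show ?thesis by (simp only: nonlinearity_eq)
qed

lemma integral_Linf_deriv_square:
  assumes t: "0 \<le> t"
  shows "(LINT x|M. \<bar>Linf_deriv \<Omega> {0..} u t x\<bar>\<^sup>2)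
    = (LINT x|M. g (u t x) ^ 2 * (p (u t x) - lam t)\<^sup>2)"
proof (rule integral_cong_AE)
  have "Linf_deriv \<Omega> {0..} u t \<in> Linf \<Omega>"
    using someI[of "\<lambda>w. has_Linf_derivative \<Omega> {0..} u w t", OF flow[OF t]]
    by (simp add: has_Linf_derivative_def Linf_deriv_def)
  then have [measurable]: "Linf_deriv \<Omega> {0..} u t \<in> borel_measurable M"
    by (simp add: Linf_def)
  show "(\<lambda>x. \<bar>Linf_deriv \<Omega> {0..} u t x\<bar>\<^sup>2) \<in> borel_measurable M" by measurable
  have "integrable M (\<lambda>x. g (u t x) ^ 2 * (p (u t x) - lam t)\<^sup>2)"
    by (intro integrable_compose[OF t, of "\<lambda>y. g y ^ 2 * (p y - lam t)\<^sup>2"]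
        continuous_intros cont_p cont_g)
  then show "(\<lambda>x. g (u t x) ^ 2 * (p (u t x) - lam t)\<^sup>2) \<in> borel_measurable M"
    by (rule borel_measurable_integrable)
  show "AE x in M. \<bar>Linf_deriv \<Omega> {0..} u t x\<bar>\<^sup>2 = g (u t x) ^ 2 * (p (u t x) - lam t)\<^sup>2"
    using Linf_deriv_AE[OF t] by eventually_elim (simp add: power_mult_distrib)
qed

text \<open>With \<open>\<epsilon> * g (u) \<le> 0\<close> and
  \<open>\<bar>\<epsilon>\<bar> = 1\<close> one has
  \<open>\<bar>g (u)\<bar> = - \<epsilon> * g (u)\<close>, so one factor of
  \<open>g (u)\<^sup>2\<close> can be traded for the bound \<open>G\<close>.\<close>

lemma integral_Linf_deriv_square_le:
  assumes t: "0 \<le> t" and sign: "AE x in M. \<epsilon> * g (u t x) \<le> 0" and "\<bar>\<epsilon>\<bar> = 1"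
    and G: "AE x in M. \<bar>g (u t x)\<bar> \<le> G"
  shows "(LINT x|M. \<bar>Linf_deriv \<Omega> {0..} u t x\<bar>\<^sup>2)
    \<le> - G * \<epsilon> * (LINT x|M. g (u t x) * (p (u t x) - lam t)\<^sup>2)"
proof -
  have "(LINT x|M. g (u t x) ^ 2 * (p (u t x) - lam t)\<^sup>2)
      \<le> (LINT x|M. - G * \<epsilon> * (g (u t x) * (p (u t x) - lam t)\<^sup>2))"
  proof (rule integral_mono_AE)
    show "integrable M (\<lambda>x. g (u t x) ^ 2 * (p (u t x) - lam t)\<^sup>2)"
      by (intro integrable_compose[OF t, of "\<lambda>y. g y ^ 2 * (p y - lam t)\<^sup>2"]
          continuous_intros cont_p cont_g)
    show "integrable M (\<lambda>x. - G * \<epsilon> * (g (u t x) * (p (u t x) - lam t)\<^sup>2))"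
      by (intro integrable_compose[OF t, of "\<lambda>y. - G * \<epsilon> * (g y * (p y - lam t)\<^sup>2)"]
          continuous_intros cont_p cont_g)
    show "AE x in M. g (u t x) ^ 2 * (p (u t x) - lam t)\<^sup>2
        \<le> - G * \<epsilon> * (g (u t x) * (p (u t x) - lam t)\<^sup>2)"
      using sign G
    proof eventually_elim
      case (elim x)
      have "\<bar>g (u t x)\<bar> = - \<epsilon> * g (u t x)"
        using elim(1) abs_of_nonpos[OF elim(1)] \<open>\<bar>\<epsilon>\<bar> = 1\<close> by (simp add: abs_mult)
      moreover have "g (u t x) ^ 2 \<le> G * \<bar>g (u t x)\<bar>"
        using mult_right_mono[OF elim(2), of "\<bar>g (u t x)\<bar>"] by (simp add: power2_eq_square)
      ultimately have "g (u t x) ^ 2 \<le> - G * \<epsilon> * g (u t x)" by simp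
      from mult_right_mono[OF this, of "(p (u t x) - lam t)\<^sup>2"] show ?case by (simp add: mult.assoc)
    qed
  qed
  then show ?thesis unfolding integral_Linf_deriv_square[OF t] by simp
qed

lemma energy_dissipation:
  assumes sign: "\<And>t. 0 \<le> t \<Longrightarrow> AE x in M. \<epsilon> * g (u t x) \<le> 0" and \<epsilon>: "\<bar>\<epsilon>\<bar> = 1" and "0 < G"
    and G: "\<And>t. 0 \<le> t \<Longrightarrow> AE x in M. \<bar>g (u t x)\<bar> \<le> G" and ab: "0 \<le> a" "a \<le> b"
  shows "\<epsilon> * (LINT t|lebesgue_on {a..b}. LINT x|M. g (u t x) * (p (u t x) - lam t)\<^sup>2)
    \<le> - (1 / G) * (LINT t|lebesgue_on {a..b}. LINT x|M. \<bar>Linf_deriv \<Omega> {0..} u t x\<bar>\<^sup>2)"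
proof -
  let ?d = "\<lambda>t. LINT x|M. g (u t x) * (p (u t x) - lam t)\<^sup>2"
  let ?w = "\<lambda>t. LINT x|M. \<bar>Linf_deriv \<Omega> {0..} u t x\<bar>\<^sup>2"
  have d: "integrable (lebesgue_on {a..b}) ?d"
    using continuous_on_subset[OF cont_integral_weighted_variance[of 1], of "{a..b}"] ab
    by (intro continuous_imp_integrable_real) auto
  have "continuous_on {a..b} ?w"
    using continuous_on_subset[OF cont_integral_weighted_variance[of 2], of "{a..b}"] ab
    \<comment> \<open>The representatives are chosen separately for each time; continuity comes from
      replacing their square integrals by the weighted variances with \<open>j = 2\<close>.\<close>
    by (subst continuous_on_cong[OF refl integral_Linf_deriv_square]) auto
  then have w: "integrable (lebesgue_on {a..b}) ?w"
    by (rule continuous_imp_integrable_real)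
  have "(LINT t|lebesgue_on {a..b}. ?w t) \<le> (LINT t|lebesgue_on {a..b}. - G * \<epsilon> * ?d t)"
  proof (rule integral_mono[OF w])
    show "integrable (lebesgue_on {a..b}) (\<lambda>t. - G * \<epsilon> * ?d t)" using d by simp
    fix t assume "t \<in> space (lebesgue_on {a..b})"
    then have "0 \<le> t" using ab by (simp add: space_restrict_space)
    then show "?w t \<le> - G * \<epsilon> * ?d t" by (intro integral_Linf_deriv_square_le sign \<epsilon> G)
  qed
  then have "(LINT t|lebesgue_on {a..b}. ?w t) \<le> - G * \<epsilon> * (LINT t|lebesgue_on {a..b}. ?d t)"
    by simp
  with \<open>0 < G\<close> show ?thesis by (simp add: field_simps)
qed

text \<open>Two facts about the solution suffice: a fixed sign of \<open>g (u)\<close> and a bound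
  on \<open>u\<close> independent of time. The bound supplies both the dissipation constant and a
  lower bound for the energy, hence the limit.\<close>

lemma energy_conclusion:
  assumes sign: "\<And>t. 0 \<le> t \<Longrightarrow> AE x in M. (-1) ^ (i + 1) * g (u t x) \<le> 0"
    and R: "\<And>t. 0 \<le> t \<Longrightarrow> AE x in M. \<bar>u t x\<bar> \<le> R"
  shows "(\<exists>C>0. \<forall>\<tau>1 \<tau>2. 0 \<le> \<tau>1 \<and> \<tau>1 < \<tau>2 \<longrightarrow>
        energy \<Omega> p i (u \<tau>2) - energy \<Omega> p i (u \<tau>1) =
          (-1) ^ (i + 1) * (LINT t|lebesgue_on {\<tau>1..\<tau>2}. LINT x|M.
             g (u t x) * (p (u t x) - lam t)\<^sup>2) \<and>
        (-1) ^ (i + 1) * (LINT t|lebesgue_on {\<tau>1..\<tau>2}. LINT x|M.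
             g (u t x) * (p (u t x) - lam t)\<^sup>2)
          \<le> - C * (LINT t|lebesgue_on {\<tau>1..\<tau>2}. LINT x|M. \<bar>Linf_deriv \<Omega> {0..} u t x\<bar>\<^sup>2) \<and>
        - C * (LINT t|lebesgue_on {\<tau>1..\<tau>2}. LINT x|M. \<bar>Linf_deriv \<Omega> {0..} u t x\<bar>\<^sup>2) \<le> 0) \<and>
     continuous_on {0..} (\<lambda>t. energy \<Omega> p i (u t)) \<and>
     antimono_on {0..} (\<lambda>t. energy \<Omega> p i (u t)) \<and>
     (\<exists>Einf. ((\<lambda>t. energy \<Omega> p i (u t)) \<longlongrightarrow> Einf) at_top)"
proof -
  let ?\<epsilon> = "(-1) ^ (i + 1) :: real" and ?E = "\<lambda>t. energy \<Omega> p i (u t)"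
  let ?d = "\<lambda>a b. LINT t|lebesgue_on {a..b}. LINT x|M. g (u t x) * (p (u t x) - lam t)\<^sup>2"
  let ?w = "\<lambda>a b. LINT t|lebesgue_on {a..b}. LINT x|M. \<bar>Linf_deriv \<Omega> {0..} u t x\<bar>\<^sup>2"
  obtain G where G: "0 < G" "\<And>y. y \<in> {-R..R} \<Longrightarrow> \<bar>g y\<bar> \<le> G"
    using continuous_bounded_on_interval[OF cont_g, of "-R" R] by blast
  have g_bound: "AE x in M. \<bar>g (u t x)\<bar> \<le> G" if "0 \<le> t" for t
    using R[OF that] by eventually_elim (rule G(2), auto)
  have \<epsilon>: "\<bar>?\<epsilon>\<bar> = 1" by (simp add: power_abs)
  have eq: "?E b - ?E a = ?\<epsilon> * ?d a b" if "0 \<le> a" "a \<le> b" for a b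
    using potential_difference[OF that] by (simp only: energy_def right_diff_distrib)
  have le: "?\<epsilon> * ?d a b \<le> - (1 / G) * ?w a b" if "0 \<le> a" "a \<le> b" for a b
    using that by (intro energy_dissipation sign \<epsilon> G(1) g_bound)
  have w: "- (1 / G) * ?w a b \<le> 0" for a b
    using G(1) by (auto intro!: divide_nonneg_pos integral_nonneg)
  have anti: "antimono_on {0..} ?E"
  proof (rule monotone_onI)
    fix a b :: real assume "a \<in> {0..}" "b \<in> {0..}" "a \<le> b"
    then show "?E b \<le> ?E a" using eq[of a b] le[of a b] w[of a b] by simp
  qed
  have contP: "continuous_on S (primitive p)" for S
    using has_real_derivative_primitive[OF cont_p] by (rule everywhere_deriv_continuous_on)
  obtain B where B: "0 < B" "\<And>y. y \<in> {-R..R} \<Longrightarrow> \<bar>primitive p y\<bar> \<le> B"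
    using continuous_bounded_on_interval[OF contP, of "-R" R] by blast
  have "- (B * measure M (space M)) \<le> ?E t" if t: "0 \<le> t" for t
  proof -
    have int: "integrable M (\<lambda>x. primitive p (u t x))" by (rule integrable_compose[OF t contP])
    have "norm (LINT x|M. primitive p (u t x)) \<le> (LINT x|M. norm (primitive p (u t x)))"
      by (rule integral_norm_bound)
    also have "\<dots> \<le> (LINT x|M. B)"
    proof (rule integral_mono_AE)
      show "integrable M (\<lambda>x. norm (primitive p (u t x)))" using int by (rule integrable_norm)
      show "integrable M (\<lambda>x. B)" using finite_domain by (simp add: finite_measure.integrable_const)
      show "AE x in M. norm (primitive p (u t x)) \<le> B"
        using R[OF t] by eventually_elim (unfold real_norm_def, rule B(2), auto)
    qed
    finally have "norm (LINT x|M. primitive p (u t x)) \<le> (LINT x|M. B)" .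
    moreover have "\<bar>?E t\<bar> = \<bar>LINT x|M. primitive p (u t x)\<bar>"
      by (simp add: energy_def abs_mult power_abs)
    ultimately show ?thesis by (simp add: mult.commute)
  qed
  then have "(?E \<longlongrightarrow> (INF t\<in>{0..}. ?E t)) at_top"
    by (rule antimono_on_bounded_below_convergent[OF anti])
  moreover have "continuous_on {0..} ?E"
    unfolding energy_def by (intro continuous_intros cont_potential)
  moreover have "\<exists>C>0. \<forall>\<tau>1 \<tau>2. 0 \<le> \<tau>1 \<and> \<tau>1 < \<tau>2 \<longrightarrow>
      ?E \<tau>2 - ?E \<tau>1 = ?\<epsilon> * ?d \<tau>1 \<tau>2 \<and> ?\<epsilon> * ?d \<tau>1 \<tau>2 \<le> - C * ?w \<tau>1 \<tau>2 \<and> - C * ?w \<tau>1 \<tau>2 \<le> 0"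
    \<comment> \<open>The constant is the reciprocal of a bound for \<open>\<bar>g\<bar>\<close> on
      \<open>{-R..R}\<close>, so it does not depend on the two times.\<close>
    using G(1) by (intro exI[of _ "1 / G"] conjI allI impI eq le w) auto
  ultimately show ?thesis using anti by blast
qed

end

section \<open>Sign of \<open>g (u)\<close> and uniform bounds under the three initial
  hypotheses\<close>

theorem lemma4p1:
  fixes \<Omega> :: "(real ^ 'n) set"
    and p g :: "real \<Rightarrow> real"
    and u0 :: "real ^ 'n \<Rightarrow> real"
    and u :: "real \<Rightarrow> real ^ 'n \<Rightarrow> real"
    and i :: nat
  assumes "open \<Omega>" and "bounded \<Omega>"
    and "p C1_differentiable_on UNIV" and "strict_mono p"
    and "g C1_differentiable_on UNIV" and "g 0 = 0" and "g 1 = 0"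
    and "\<And>s. s \<in> {0<..<1} \<Longrightarrow> g s > 0"
    and "\<And>s. s \<in> {..<0} \<union> {1<..} \<Longrightarrow> g s < 0"
    and "(i = 1 \<and> H1 \<Omega> u0) \<or> (i = 2 \<and> H2 \<Omega> g u0) \<or> (i = 3 \<and> H3 \<Omega> u0)"
    and "solution_P \<Omega> p g u0 \<infinity> u"
  shows
    "(\<exists>C>0. \<forall>\<tau>1 \<tau>2. 0 \<le> \<tau>1 \<and> \<tau>1 < \<tau>2 \<longrightarrow>
        energy \<Omega> p i (u \<tau>2) - energy \<Omega> p i (u \<tau>1) =
          (-1) ^ (i + 1) * (LINT t|lebesgue_on {\<tau>1..\<tau>2}. LINT x|lebesgue_on \<Omega>.
             g (u t x) * (p (u t x) - multiplier \<Omega> p g (u t))\<^sup>2) \<and>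
        (-1) ^ (i + 1) * (LINT t|lebesgue_on {\<tau>1..\<tau>2}. LINT x|lebesgue_on \<Omega>.
             g (u t x) * (p (u t x) - multiplier \<Omega> p g (u t))\<^sup>2)
          \<le> - C * (LINT t|lebesgue_on {\<tau>1..\<tau>2}. LINT x|lebesgue_on \<Omega>.
               \<bar>Linf_deriv \<Omega> {0..} u t x\<bar>\<^sup>2) \<and>
        - C * (LINT t|lebesgue_on {\<tau>1..\<tau>2}. LINT x|lebesgue_on \<Omega>.
               \<bar>Linf_deriv \<Omega> {0..} u t x\<bar>\<^sup>2) \<le> 0) \<and>
     continuous_on {0..} (\<lambda>t. energy \<Omega> p i (u t)) \<and>
     antimono_on {0..} (\<lambda>t. energy \<Omega> p i (u t)) \<and>
     (\<exists>Einf. ((\<lambda>t. energy \<Omega> p i (u t)) \<longlongrightarrow> Einf) at_top)"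
proof -
  obtain p' where p': "\<And>y. (p has_real_derivative p' y) (at y)" "continuous_on UNIV p'"
    using C1_has_real_derivative[OF assms(3)] by blast
  obtain g' where g': "\<And>y. (g has_real_derivative g' y) (at y)" "continuous_on UNIV g'"
    using C1_has_real_derivative[OF assms(5)] by blast
  have I: "{t. 0 \<le> t \<and> ereal t < \<infinity>} = {0..}" by auto
  have sol: "C1_Linf \<Omega> {0..} u" "AE x in lebesgue_on \<Omega>. u 0 x = u0 x"
    "\<And>t. 0 \<le> t \<Longrightarrow> (LINT x|lebesgue_on \<Omega>. g (u t x)) \<noteq> 0"
    "\<And>t. 0 \<le> t \<Longrightarrow> has_Linf_derivative \<Omega> {0..} u (nonlinearity \<Omega> p g (u t)) t"
    using assms(11) unfolding solution_P_def Let_def I by auto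
  have "\<Omega> \<in> lmeasurable"
    using assms(1,2) by (intro bounded_set_imp_lmeasurable) auto
  then interpret nonlocal_flow \<Omega> p g p' g' u
  proof (intro nonlocal_flow.intro finite_measure_lebesgue_on p' g' sol)
    show "u t \<in> Linf \<Omega>" if "0 \<le> t" for t using sol(1) that by (simp add: C1_Linf_def)
  qed
  have mono: "mono p" using assms(4) by (rule strict_mono_mono)
  have g_nonpos: "g s \<le> 0" if "s \<le> 0 \<or> 1 \<le> s" for s
    using that assms(6,7) assms(9)[of s] by (cases "s = 0 \<or> s = 1") auto
  have g_nonneg: "0 \<le> g s" if "0 \<le> s" "s \<le> 1" for s
    using that assms(6,7) assms(8)[of s] by (cases "s = 0 \<or> s = 1") auto
  have ge: "AE x in M. c \<le> u t x" if "g c = 0" "AE x in M. c \<le> u0 x" "0 \<le> t" for c t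
  proof -
    have "AE x in M. -1 * (u 0 x - c) \<le> 0" using sol(2) that(2) by eventually_elim simp
    from equilibrium_barrier[OF _ that(1) this that(3)] show ?thesis by simp
  qed
  have le: "AE x in M. u t x \<le> c" if "g c = 0" "AE x in M. u0 x \<le> c" "0 \<le> t" for c t
  proof -
    have "AE x in M. 1 * (u 0 x - c) \<le> 0" using sol(2) that(2) by eventually_elim simp
    from equilibrium_barrier[OF _ that(1) this that(3)] show ?thesis by simp
  qed
  \<comment> \<open>One constant serves twice: \<open>m\<close> is the upper level when
    \<open>i = 1\<close>, and \<open>- m\<close> is the lower level when
    \<open>i = 3\<close>.\<close>
  obtain m where m: "0 < m" "AE x in M. \<bar>u 0 x\<bar> \<le> m"
    using Linf_AE_bounded[OF u_Linf[of 0]] by auto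
  consider "i = 1" "H1 \<Omega> u0" | "i = 2" "H2 \<Omega> g u0" | "i = 3" "H3 \<Omega> u0" using assms(10) by blast
  \<comment> \<open>The exponent \<open>i + 1\<close> is even for \<open>i = 1\<close> and
    \<open>i = 3\<close>, where \<open>g (u) \<le> 0\<close> is claimed, and odd for
    \<open>i = 2\<close>, where \<open>g (u) \<ge> 0\<close> is claimed.\<close>
  then have "(\<forall>t\<ge>0. AE x in M. (-1) ^ (i + 1) * g (u t x) \<le> 0) \<and>
    (\<exists>R. \<forall>t\<ge>0. AE x in M. \<bar>u t x\<bar> \<le> R)"
  proof cases
    case 1
    have u: "AE x in M. 1 \<le> u t x" if "0 \<le> t" for t
      using 1(2) that assms(7) by (intro ge) (auto simp: H1_def)
    have g_le: "AE x in M. g (u t x) \<le> 0" if "0 \<le> t" for t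
      using u[OF that] by eventually_elim (simp add: g_nonpos)
    \<comment> \<open>The equilibrium 1 bounds \<open>u\<close> from below only; the level
      \<open>m\<close> need not be an equilibrium, and its persistence rests on the sign just
      obtained.\<close>
    have "AE x in M. 1 * (u 0 x - m) \<le> 0" using m(2) by eventually_elim simp
    from level_barrier[OF _ mono g_le this]
    have "AE x in M. u t x - m \<le> 0" if "0 \<le> t" for t using that by simp
    then have "AE x in M. \<bar>u t x\<bar> \<le> m" if "0 \<le> t" for t
      using u[OF that] that by fastforce
    with g_le show ?thesis using 1(1) by auto
  next
    case 2
    \<comment> \<open>Both equilibria act as barriers here and confine the solution to
      \<open>[0, 1]\<close>, which gives the sign and the bound at once.\<close>
    have u: "AE x in M. 0 \<le> u t x \<and> u t x \<le> 1" if "0 \<le> t" for t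
    proof -
      have "AE x in M. 0 \<le> u0 x" "AE x in M. u0 x \<le> 1" using 2(2) by (auto simp: H2_def)
      from ge[OF assms(6) this(1) that] le[OF assms(7) this(2) that] show ?thesis by auto
    qed
    have "AE x in M. - g (u t x) \<le> 0" if "0 \<le> t" for t
      using u[OF that] by eventually_elim (simp add: g_nonneg)
    moreover have "AE x in M. \<bar>u t x\<bar> \<le> 1" if "0 \<le> t" for t
      using u[OF that] by eventually_elim simp
    ultimately show ?thesis using 2(1) by auto
  next
    case 3
    have u: "AE x in M. u t x \<le> 0" if "0 \<le> t" for t
      using 3(2) that assms(6) by (intro le) (auto simp: H3_def)
    have g_le: "AE x in M. g (u t x) \<le> 0" if "0 \<le> t" for t
      using u[OF that] by eventually_elim (simp add: g_nonpos)
    have "AE x in M. -1 * (u 0 x - (- m)) \<le> 0" using m(2) by eventually_elim simp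
    from level_barrier[OF _ mono g_le this]
    have "AE x in M. -1 * (u t x - (- m)) \<le> 0" if "0 \<le> t" for t using that by simp
    then have "AE x in M. \<bar>u t x\<bar> \<le> m" if "0 \<le> t" for t
      using u[OF that] that by fastforce
    with g_le show ?thesis using 3(1) by auto
  qed
  then obtain R where "\<And>t. 0 \<le> t \<Longrightarrow> AE x in M. (-1) ^ (i + 1) * g (u t x) \<le> 0"
    "\<And>t. 0 \<le> t \<Longrightarrow> AE x in M. \<bar>u t x\<bar> \<le> R"
    by blast
  then show ?thesis by (rule energy_conclusion)
qed

end
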